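(* For all $f\in U_{\phi}([0,\infty))$, $$\lim_{n\to\infty}\|V_n^{\rho}(f;\cdot)-f\|_{\phi^{3/2}}=0 .$$
   Context: Let $\rho:[0,\infty)\to\mathbb{R}$ be continuously differentiable on $[0,\infty)$ with $\rho(0)=0$ and $\inf_{x\in[0,\infty)}\rho'(x)\ge 1$ (so $\rho$ is a bijection of $[0,\infty)$ onto itself, with inverse $\rho^{-1}$). For $n\in\mathbb{N}$ ($n\ge 1$), $x\in[0,\infty)$ and $f:[0,\infty)\to\mathbb{R}$ for which the series converges, the generalized Baskakov operator is $$V_n^{\rho}(f;x)=\sum_{k=0}^{\infty}(f\circ\rho^{-1})\left(\frac{k}{n}\right)\binom{n+k-1}{k}\frac{(\rho(x))^k}{(1+\rho(x))^{n+k}} .$$ Put $\phi(x)=1+\rho^2(x)$, where $\rho^2(x)=(\rho(x))^2$. $C_{\phi}([0,\infty))$ is the set of all continuous $f:[0,\infty)\to\mathbb{R}$ for which there is a constant $M_f$ (depending on $f$) with $|f(x)|\le M_f\phi(x)$ for all $x\in[0,\infty)$. $U_{\phi}([0,\infty))$ is the set of all $f\in C_{\phi}([0,\infty))$ such that $\frac{f(x)}{\phi(x)}$ is uniformly continuous on $[0,\infty)$. The norm with weight $\phi^{3/2}$ is $\|g\|_{\phi^{3/2}}=\sup_{x\in[0,\infty)}\frac{|g(x)|}{\phi(x)^{3/2}}$. *)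

theory Defs
  imports "HOL-Analysis.Analysis"
begin

(* Functions on [0,\<infinity>) are total functions on the reals that are only ever evaluated on {0..};
   derivatives are taken within {0..}, hence one-sided at 0. The infimum is formed in the extended
   reals, where it exists without a boundedness assumption. *)
definition admissible_rho :: "(real \<Rightarrow> real) \<Rightarrow> bool" where
  "admissible_rho \<rho> \<longleftrightarrow> \<rho> 0 = 0 \<and>
     (\<exists>\<rho>'. (\<forall>x\<in>{0..}. (\<rho> has_real_derivative \<rho>' x) (at x within {0..})) \<and>
           continuous_on {0..} \<rho>' \<and> (INF x\<in>{0..}. ereal (\<rho>' x)) \<ge> 1)"

definition rho_inv :: "(real \<Rightarrow> real) \<Rightarrow> real \<Rightarrow> real" where
  "rho_inv \<rho> = the_inv_into {0..} \<rho>"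

(* The (n + k - 1) is truncated subtraction, so only n \<ge> 1 is meaningful. *)
definition baskakov_term :: "(real \<Rightarrow> real) \<Rightarrow> nat \<Rightarrow> (real \<Rightarrow> real) \<Rightarrow> real \<Rightarrow> nat \<Rightarrow> real" where
  "baskakov_term \<rho> n f x k =
     (f \<circ> rho_inv \<rho>) (real k / real n) * real ((n + k - 1) choose k) *
       (\<rho> x ^ k / (1 + \<rho> x) ^ (n + k))"

definition baskakov :: "(real \<Rightarrow> real) \<Rightarrow> nat \<Rightarrow> (real \<Rightarrow> real) \<Rightarrow> real \<Rightarrow> real" where
  "baskakov \<rho> n f x = (\<Sum>k. baskakov_term \<rho> n f x k)"

definition weight :: "(real \<Rightarrow> real) \<Rightarrow> real \<Rightarrow> real" where
  "weight \<rho> x = 1 + (\<rho> x)\<^sup>2"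

definition C_weight :: "(real \<Rightarrow> real) \<Rightarrow> (real \<Rightarrow> real) set" where
  "C_weight \<phi> = {f. continuous_on {0..} f \<and> (\<exists>M. \<forall>x\<in>{0..}. \<bar>f x\<bar> \<le> M * \<phi> x)}"

definition U_weight :: "(real \<Rightarrow> real) \<Rightarrow> (real \<Rightarrow> real) set" where
  "U_weight \<phi> = {f \<in> C_weight \<phi>. uniformly_continuous_on {0..} (\<lambda>x. f x / \<phi> x)}"

(* Valued in the extended reals: \<infinity> if the quotient is unbounded. *)
definition weighted_norm :: "(real \<Rightarrow> real) \<Rightarrow> (real \<Rightarrow> real) \<Rightarrow> ereal" where
  "weighted_norm w g = (SUP x\<in>{0..}. ereal (\<bar>g x\<bar> / w x))"

lemma admissible_rho_bij_betw:
  assumes "admissible_rho \<rho>"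
  shows "bij_betw \<rho> {0..} {0..}"
proof -
  obtain \<rho>' where d: "\<And>x. x \<ge> 0 \<Longrightarrow> (\<rho> has_real_derivative \<rho>' x) (at x within {0..})"
    and i: "(INF x\<in>{0..}. ereal (\<rho>' x)) \<ge> 1" and z: "\<rho> 0 = 0"
    using assms by (auto simp: admissible_rho_def)
  have ge1: "\<rho>' x \<ge> 1" if "x \<ge> 0" for x
    using i that by (auto simp: le_INF_iff)
  have cont: "continuous_on {0..} \<rho>"
    using d by (auto intro!: DERIV_continuous_on)
  have grow: "\<rho> b - \<rho> a \<ge> b - a" if "0 \<le> a" "a < b" for a b
  proof -
    have "\<exists>\<xi>\<in>{a<..<b}. \<rho> b - \<rho> a = \<rho>' \<xi> * (b - a)"
    proof (rule mvt_simple[where f' = "\<lambda>x. (*) (\<rho>' x)"])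
      show "a < b" by fact
      show "(\<rho> has_derivative (*) (\<rho>' x)) (at x within {a..b})" if "a \<le> x" "x \<le> b" for x
        using d[of x] that \<open>0 \<le> a\<close>
        by (auto simp: has_field_derivative_def intro: has_derivative_subset)
    qed
    then obtain \<xi> where "\<xi> > a" "\<rho> b - \<rho> a = \<rho>' \<xi> * (b - a)" by auto
    moreover have "1 * (b - a) \<le> \<rho>' \<xi> * (b - a)"
      using ge1[of \<xi>] \<open>\<xi> > a\<close> that by (intro mult_right_mono) auto
    ultimately show ?thesis by simp
  qed
  have inj: "inj_on \<rho> {0..}"
  proof (rule linorder_inj_onI)
    show "\<rho> x \<noteq> \<rho> y" if "x < y" "x \<in> {0..}" "y \<in> {0..}" for x y
      using grow[of x y] that by auto
  qed auto
  have le: "x \<le> \<rho> x" if "x \<ge> 0" for x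
    using grow[of 0 x] z that by (cases "x = 0") auto
  have surj: "y \<in> \<rho> ` {0..}" if "y \<ge> 0" for y
  proof -
    have "\<exists>x\<ge>0. x \<le> y \<and> \<rho> x = y"
      by (rule IVT') (use z le[of y] that continuous_on_subset[OF cont] in auto)
    then show ?thesis by force
  qed
  show ?thesis
    unfolding bij_betw_def using inj surj le by force
qed

lemma summable_baskakov_term:
  assumes "admissible_rho \<rho>" "f \<in> C_weight (weight \<rho>)" "n \<ge> 1" "x \<ge> 0"
  shows "summable (baskakov_term \<rho> n f x)"
proof -
  have bij: "bij_betw \<rho> {0..} {0..}" using assms(1) by (rule admissible_rho_bij_betw)
  have y: "\<rho> x \<ge> 0" using bij assms(4) by (auto simp: bij_betw_def)
  define q where "q = \<rho> x / (1 + \<rho> x)"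
  have q: "0 \<le> q" "q < 1" using y by (auto simp: q_def)
  obtain M where M: "\<And>x. x \<ge> 0 \<Longrightarrow> \<bar>f x\<bar> \<le> M * (1 + (\<rho> x)\<^sup>2)"
    using assms(2) by (auto simp: C_weight_def weight_def)
  have M0: "M \<ge> 0"
    using M[of 0] assms(1) by (auto simp: admissible_rho_def)
  have fb: "\<bar>f (rho_inv \<rho> t)\<bar> \<le> M * (1 + t\<^sup>2)" if "t \<ge> 0" for t
  proof -
    have "\<rho> (rho_inv \<rho> t) = t" "rho_inv \<rho> t \<ge> 0"
      using bij that f_the_inv_into_f_bij_betw[OF bij, of t] the_inv_into_into[of \<rho> "{0..}" t "{0..}"]
      by (auto simp: rho_inv_def bij_betw_def)
    with M[of "rho_inv \<rho> t"] show ?thesis by simp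
  qed
  have *: "norm (baskakov_term \<rho> n f x k) \<le> M * (real (n + k) ^ (n + 2) * q ^ k)" for k
  proof -
    have "real k / real n \<le> real k" using assms(3) by (simp add: divide_le_eq mult_le_cancel_left1)
    then have "(real k / real n)\<^sup>2 \<le> (real k)\<^sup>2" by (intro power_mono) auto
    also have "1 + (real k)\<^sup>2 \<le> (real (n + k))\<^sup>2"
    proof -
      have "(1 + real k)\<^sup>2 \<le> (real (n + k))\<^sup>2" using assms(3) by (intro power_mono) auto
      then show ?thesis by (simp add: power2_eq_square algebra_simps)
    qed
    finally have "1 + (real k / real n)\<^sup>2 \<le> (real (n + k))\<^sup>2" by simp
    with M0 have a: "\<bar>f (rho_inv \<rho> (real k / real n))\<bar> \<le> M * (real (n + k))\<^sup>2"
      by (intro order.trans[OF fb] mult_left_mono) auto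
    have "((n + k - 1) choose k) = ((n + k - 1) choose (n - 1))"
      using assms(3) by (subst binomial_symmetric) auto
    also have "\<dots> \<le> (n + k - 1) ^ (n - 1)"
      by (rule binomial_le_pow) simp
    also have "\<dots> \<le> (n + k) ^ (n - 1)"
      by (intro power_mono) auto
    also have "\<dots> \<le> (n + k) ^ n"
      using assms(3) by (intro power_increasing) auto
    finally have b: "real ((n + k - 1) choose k) \<le> real (n + k) ^ n"
      by (metis of_nat_le_iff of_nat_power)
    have c: "\<rho> x ^ k / (1 + \<rho> x) ^ (n + k) \<le> q ^ k"
    proof -
      have "\<rho> x ^ k * 1 \<le> \<rho> x ^ k * (1 + \<rho> x) ^ n"
        using y by (intro mult_left_mono one_le_power) auto
      then show ?thesis
        using y by (simp add: q_def power_divide power_add field_simps)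
    qed
    have "norm (baskakov_term \<rho> n f x k) =
        \<bar>f (rho_inv \<rho> (real k / real n))\<bar> * real ((n + k - 1) choose k) *
          (\<rho> x ^ k / (1 + \<rho> x) ^ (n + k))"
      using y by (simp add: baskakov_term_def abs_mult)
    also have "\<dots> \<le> (M * (real (n + k))\<^sup>2) * real (n + k) ^ n * q ^ k"
      using M0 y by (intro mult_mono a b c mult_nonneg_nonneg) auto
    finally show ?thesis by (simp add: power_add power2_eq_square mult_ac)
  qed
  have "summable (\<lambda>k. real (n + k) ^ (n + 2) * q ^ k)"
  proof -
    have "(\<lambda>k. (1 + 1 / real (n + k)) ^ (n + 2) * q) \<longlonglongrightarrow> (1 + 0) ^ (n + 2) * q"
    proof (intro tendsto_intros)
      have "(\<lambda>k. 1 / real k) \<longlonglongrightarrow> 0" by (rule lim_1_over_n)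
      then show "(\<lambda>k. 1 / real (n + k)) \<longlonglongrightarrow> 0"
        using LIMSEQ_ignore_initial_segment[of "\<lambda>k. 1 / real k" 0 n] by (simp add: add.commute)
    qed
    then have "\<forall>\<^sub>F k in sequentially. (1 + 1 / real (n + k)) ^ (n + 2) * q < (1 + q) / 2"
      using q by (intro order_tendstoD) auto
    then obtain N where N: "\<And>k. k \<ge> N \<Longrightarrow> (1 + 1 / real (n + k)) ^ (n + 2) * q < (1 + q) / 2"
      by (auto simp: eventually_sequentially)
    show ?thesis
    proof (rule summable_ratio_test[of "(1 + q) / 2" N])
      show "(1 + q) / 2 < 1" using q by simp
      fix k assume "k \<ge> N"
      have "real (n + Suc k) = real (n + k) * (1 + 1 / real (n + k))"
        using assms(3) by (simp add: field_simps)
      then have "real (n + Suc k) ^ (n + 2) * q ^ Suc k =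
          ((1 + 1 / real (n + k)) ^ (n + 2) * q) * (real (n + k) ^ (n + 2) * q ^ k)"
        by (simp only: power_mult_distrib power_Suc mult_ac)
      also have "\<dots> \<le> (1 + q) / 2 * (real (n + k) ^ (n + 2) * q ^ k)"
        using N[OF \<open>k \<ge> N\<close>] q by (intro mult_right_mono) auto
      finally show "norm (real (n + Suc k) ^ (n + 2) * q ^ Suc k)
          \<le> (1 + q) / 2 * norm (real (n + k) ^ (n + 2) * q ^ k)"
        using q by (simp add: abs_mult)
    qed
  qed
  from summable_mult[OF this, of M] show ?thesis
    by (rule summable_comparison_test') (rule *)
qed

end

theory Submission
  imports Defs
begin

text \<open>
  Substituting \<open>t = \<rho> x\<close> reduces the claim to the classical Baskakov operator and \<open>h = f \<circ> \<rho>\<^sup>-\<^sup>1\<close>;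
  as \<open>\<rho>' \<ge> 1\<close>, the inverse of \<open>\<rho>\<close> is 1-Lipschitz, so \<open>F t = h t / (1 + t\<^sup>2)\<close> is still uniformly
  continuous. As \<open>\<bar>F\<bar> \<le> M\<close>, it follows that \<open>\<bar>F t - F y\<bar> \<le> \<epsilon> + 2 M \<bar>t - y\<bar> / \<delta>\<close>. Averaging this,
  multiplied by \<open>1 + t\<^sup>2\<close>, requires \<open>E (\<bar>t - y\<bar> (1 + t\<^sup>2))\<close>, which is of order
  \<open>(1 + y\<^sup>2) powr (3 / 2) / sqrt n\<close>: this is where the exponent 3/2 comes from. A bound quadratic in
  \<open>\<bar>t - y\<bar>\<close> would not do, since \<open>E ((t - y)\<^sup>2 (1 + t\<^sup>2))\<close> grows like \<open>y ^ 4 / n\<close>.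
\<close>

section \<open>Baskakov basis: normalization and raw moments\<close>

text \<open>The negative binomial distribution: the probability of \<open>k\<close> failures before
  the \<open>n\<close>-th success when the success probability is \<open>1 / (1 + y)\<close>. The
  count \<open>k\<close> has mean \<open>n * y\<close>, so the nodes \<open>k / n\<close> are
  centred at \<open>y\<close>.\<close>

definition baskakov_basis :: "nat \<Rightarrow> real \<Rightarrow> nat \<Rightarrow> real" where
  "baskakov_basis n y k = real ((n + k - 1) choose k) * (y ^ k / (1 + y) ^ (n + k))"

lemma baskakov_basis_nonneg: "y \<ge> 0 \<Longrightarrow> baskakov_basis n y k \<ge> 0"
  by (simp add: baskakov_basis_def)

text \<open>Newton's series for the exponent \<open>- n\<close> at \<open>z = - y / (1 + y)\<close>;
  this point lies in the unit disc for every \<open>y \<ge> 0\<close>, and there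
  \<open>1 + z = 1 / (1 + y)\<close>.\<close>

lemma baskakov_basis_sums_1:
  assumes "n \<ge> 1" "y \<ge> 0"
  shows "baskakov_basis n y sums 1"
proof -
  define z where "z = - (y / (1 + y))"
  have z: "\<bar>z\<bar> < 1" "1 + z = 1 / (1 + y)" using assms by (auto simp: z_def field_simps)
  have "(\<lambda>k. ((- real n) gchoose k) * z ^ k) sums (1 + z) powr (- real n)"
    by (rule gen_binomial_real) (rule z)
  also have "(1 + z) powr (- real n) = (1 + y) ^ n"
    using assms by (simp add: z powr_minus powr_divide powr_realpow)
  finally have "(\<lambda>k. ((- real n) gchoose k) * z ^ k / (1 + y) ^ n) sums ((1 + y) ^ n / (1 + y) ^ n)"
    by (rule sums_divide)
  moreover have "((- real n) gchoose k) * z ^ k / (1 + y) ^ n = baskakov_basis n y k" for k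
  proof -
    \<comment> \<open>Negating the upper index produces a sign that cancels against the one in
      \<open>z ^ k\<close>. As \<open>n \<ge> 1\<close>, the truncated \<open>n + k - 1\<close>
      agrees with real subtraction even at \<open>k = 0\<close>.\<close>
    have "((- real n) gchoose k) = (- 1) ^ k * ((real n + real k - 1) gchoose k)"
      by (subst gbinomial_negated_upper) (simp add: algebra_simps)
    also have "real n + real k - 1 = real (n + k - 1)" using assms by simp
    finally have "((- real n) gchoose k) = (- 1) ^ k * real ((n + k - 1) choose k)"
      by (simp only: binomial_gbinomial)
    moreover have "z ^ k = (- 1) ^ k * (y ^ k / (1 + y) ^ k)"
      by (simp only: z_def power_minus[of "y / (1 + y)"] power_divide)
    ultimately have "((- real n) gchoose k) * z ^ k =
        ((- 1) ^ k * (- 1) ^ k) * (real ((n + k - 1) choose k) * (y ^ k / (1 + y) ^ k))"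
      by (simp only: mult_ac)
    also have "(- 1 :: real) ^ k * (- 1) ^ k = 1" by simp
    finally show ?thesis
      by (simp add: baskakov_basis_def power_add mult.commute)
  qed
  ultimately show ?thesis using assms by simp
qed

text \<open>Absorption identities for binomial coefficients: a factor equal to the index is traded
  for a step from \<open>n\<close> to \<open>Suc n\<close>. This drives the moment
  recursion.\<close>

lemma baskakov_basis_Suc:
  assumes "y \<ge> 0"
  shows "baskakov_basis n y (Suc k) * real (Suc k) = real n * y * baskakov_basis (Suc n) y k"
proof -
  have "Suc k * (n + k choose Suc k) = n * (n + k choose k)"
    using binomial_absorption[of k "n + k"] binomial_absorb_comp[of "n + k" k] by simp
  then have "real (Suc k) * real (n + k choose Suc k) = real n * real (n + k choose k)"
    by (metis of_nat_mult)
  then show ?thesis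
    by (simp add: baskakov_basis_def mult_ac del: of_nat_Suc)
qed

text \<open>The factor \<open>k\<close> kills the term at 0, so the sum can start at 1 and be
  reindexed by the absorption identity. Each power of \<open>k\<close> thus costs one increment of
  \<open>n\<close>.\<close>

lemma baskakov_basis_sums_shift:
  assumes "y \<ge> 0" "(\<lambda>k. baskakov_basis (Suc n) y k * g (Suc k)) sums L"
  shows "(\<lambda>k. baskakov_basis n y k * (real k * g k)) sums (real n * y * L)"
proof -
  have "(\<lambda>k. real n * y * (baskakov_basis (Suc n) y k * g (Suc k))) sums (real n * y * L)"
    by (intro sums_mult assms)
  also have "(\<lambda>k. real n * y * (baskakov_basis (Suc n) y k * g (Suc k))) =
      (\<lambda>k. baskakov_basis n y (Suc k) * (real (Suc k) * g (Suc k)))"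
    using baskakov_basis_Suc[OF assms(1), of n] by (simp add: fun_eq_iff mult.assoc[symmetric])
  finally show ?thesis
    by (subst (asm) sums_Suc_iff) simp
qed

text \<open>The factorial moments are \<open>n (n + 1) ... (n + j - 1) y ^ j\<close>. The right-hand
  sides are the resulting power moments in Horner form; the constants 3 and 6, 7 are Stirling
  numbers of the second kind.\<close>

lemma baskakov_basis_moments:
  assumes "n \<ge> 1" "y \<ge> 0"
  shows baskakov_basis_moment1: "(\<lambda>k. baskakov_basis n y k * real k) sums (n * y)"
    and baskakov_basis_moment2: "(\<lambda>k. baskakov_basis n y k * real k ^ 2) sums (n * y * ((real n + 1) * y + 1))"
    and baskakov_basis_moment3: "(\<lambda>k. baskakov_basis n y k * real k ^ 3) sums
      (n * y * ((real n + 1) * y * ((real n + 2) * y + 3) + 1))"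
    and baskakov_basis_moment4: "(\<lambda>k. baskakov_basis n y k * real k ^ 4) sums
      (n * y * ((real n + 1) * y * ((real n + 2) * y * ((real n + 3) * y + 6) + 7) + 1))"
proof -
  \<comment> \<open>Each moment is proved for all \<open>n \<ge> 1\<close>, since the next one at
    \<open>n\<close> uses it at \<open>Suc n\<close>, after expanding the power of
    \<open>Suc k\<close>.\<close>
  have m0: "(\<lambda>k. baskakov_basis n y k * 1) sums 1" if "n \<ge> 1" for n
    using baskakov_basis_sums_1[OF that assms(2)] by simp
  have m1: "(\<lambda>k. baskakov_basis n y k * real k) sums (n * y)" if "n \<ge> 1" for n
    using baskakov_basis_sums_shift[OF assms(2), of n "\<lambda>_. 1" 1] m0[of "Suc n"] by simp
  have m2: "(\<lambda>k. baskakov_basis n y k * real k ^ 2) sums (n * y * ((real n + 1) * y + 1))" if "n \<ge> 1" for n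
  proof -
    have "(\<lambda>k. baskakov_basis (Suc n) y k * real (Suc k)) sums (Suc n * y + 1)"
      using sums_add[OF m1[of "Suc n"] m0[of "Suc n"]] by (simp add: algebra_simps)
    from baskakov_basis_sums_shift[OF assms(2) this] show ?thesis
      by (simp add: power2_eq_square algebra_simps)
  qed
  have m3: "(\<lambda>k. baskakov_basis n y k * real k ^ 3) sums (n * y * ((real n + 1) * y * ((real n + 2) * y + 3) + 1))"
    if "n \<ge> 1" for n
  proof -
    have "(\<lambda>k. baskakov_basis (Suc n) y k * real (Suc k) ^ 2) sums
        (Suc n * y * ((real (Suc n) + 1) * y + 1) + 2 * (Suc n * y) + 1)"
      using sums_add[OF sums_add[OF m2[of "Suc n"] sums_mult[OF m1[of "Suc n"], of 2]] m0[of "Suc n"]]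
      by (simp add: power2_eq_square algebra_simps)
    from baskakov_basis_sums_shift[OF assms(2), of n "\<lambda>k. real k ^ 2", OF this] show ?thesis
      by (simp add: power2_eq_square power3_eq_cube algebra_simps)
  qed
  have m4: "(\<lambda>k. baskakov_basis n y k * real k ^ 4) sums
      (n * y * ((real n + 1) * y * ((real n + 2) * y * ((real n + 3) * y + 6) + 7) + 1))" if "n \<ge> 1" for n
  proof -
    have "(\<lambda>k. baskakov_basis (Suc n) y k * real (Suc k) ^ 3) sums
        (Suc n * y * ((real (Suc n) + 1) * y * ((real (Suc n) + 2) * y + 3) + 1)
          + 3 * (Suc n * y * ((real (Suc n) + 1) * y + 1)) + 3 * (Suc n * y) + 1)"
      using sums_add[OF sums_add[OF sums_add[OF m3[of "Suc n"] sums_mult[OF m2[of "Suc n"], of 3]]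
          sums_mult[OF m1[of "Suc n"], of 3]] m0[of "Suc n"]]
      by (simp add: power2_eq_square power3_eq_cube algebra_simps)
    from baskakov_basis_sums_shift[OF assms(2), of n "\<lambda>k. real k ^ 3", OF this] show ?thesis
      by (simp add: power2_eq_square power3_eq_cube power4_eq_xxxx algebra_simps)
  qed
  show "(\<lambda>k. baskakov_basis n y k * real k) sums (n * y)"
    "(\<lambda>k. baskakov_basis n y k * real k ^ 2) sums (n * y * ((real n + 1) * y + 1))"
    "(\<lambda>k. baskakov_basis n y k * real k ^ 3) sums (n * y * ((real n + 1) * y * ((real n + 2) * y + 3) + 1))"
    "(\<lambda>k. baskakov_basis n y k * real k ^ 4) sums
      (n * y * ((real n + 1) * y * ((real n + 2) * y * ((real n + 3) * y + 6) + 7) + 1))"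
    using m1 m2 m3 m4 assms(1) by blast+
qed

section \<open>Central and weighted moments\<close>

text \<open>The variance of the negative binomial distribution, rescaled by
  \<open>n\<^sup>2\<close>.\<close>

lemma baskakov_basis_central_moment2:
  assumes "n \<ge> 1" "y \<ge> 0"
  shows "(\<lambda>k. baskakov_basis n y k * (real k / n - y)\<^sup>2) sums (y * (1 + y) / n)"
proof -
  note m = baskakov_basis_sums_1[OF assms] baskakov_basis_moment1[OF assms] baskakov_basis_moment2[OF assms]
  have "(\<lambda>k. baskakov_basis n y k * real k ^ 2 / n\<^sup>2 - 2 * y / n * (baskakov_basis n y k * real k)
      + y\<^sup>2 * baskakov_basis n y k) sums
      ((n * y * ((real n + 1) * y + 1)) / n\<^sup>2 - 2 * y / n * (n * y) + y\<^sup>2 * 1)"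
    by (intro sums_add sums_diff sums_mult sums_divide m)
  also have "(n * y * ((real n + 1) * y + 1)) / n\<^sup>2 - 2 * y / n * (n * y) + y\<^sup>2 * 1 = y * (1 + y) / n"
    using assms by (simp add: field_simps power2_eq_square)
  finally show ?thesis
    using assms by (simp add: field_simps power2_eq_square)
qed

text \<open>Averaging the weight costs only a constant factor, uniformly in \<open>n\<close> and
  \<open>y\<close>; this controls the part of the error coming from
  \<open>\<epsilon>\<close>.\<close>

lemma baskakov_basis_weighted_moment2:
  assumes "n \<ge> 1" "y \<ge> 0"
  obtains L where "(\<lambda>k. baskakov_basis n y k * (1 + (real k / n)\<^sup>2)) sums L" "L \<le> 3 * (1 + y\<^sup>2)"
proof
  \<comment> \<open>In terms of \<open>r = 1 / n\<close> every product \<open>n * r\<close> becomes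
    1, leaving a polynomial in \<open>r\<close> and \<open>y\<close> with \<open>r\<close> between 0
    and 1; bounds on it are uniform in \<open>n\<close>.\<close>
  define r where "r = 1 / real n"
  have r: "0 \<le> r" "r \<le> 1" "real n * r = 1" using assms by (auto simp: r_def)
  note m = baskakov_basis_sums_1[OF assms] baskakov_basis_moment2[OF assms]
  have "(\<lambda>k. baskakov_basis n y k + baskakov_basis n y k * real k ^ 2 * r\<^sup>2) sums
      (1 + (n * y * ((real n + 1) * y + 1)) * r\<^sup>2)"
    by (intro sums_add sums_mult2 m)
  also have "(n * y * ((real n + 1) * y + 1)) * r\<^sup>2 = (real n * r) * y * ((real n * r + r) * y + r)"
    by (simp add: algebra_simps power2_eq_square)
  finally show "(\<lambda>k. baskakov_basis n y k * (1 + (real k / n)\<^sup>2)) sums (1 + y * ((1 + r) * y + r))"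
    unfolding r by (simp add: r_def algebra_simps power_divide)
  have "r * (y + y\<^sup>2) \<le> 1 * (y + y\<^sup>2)" using r assms by (intro mult_right_mono) auto
  moreover have "0 \<le> (y - 1)\<^sup>2" by simp
  ultimately show "1 + y * ((1 + r) * y + r) \<le> 3 * (1 + y\<^sup>2)"
    using assms by (simp add: algebra_simps power2_eq_square)
qed

text \<open>The weight raises the growth in \<open>y\<close> to degree four but keeps the decay
  \<open>1 / n\<close> of the variance. The square of the weight on the right is what later yields
  the exponent 3/2, after division by a quantity of order
  \<open>sqrt (1 + y\<^sup>2)\<close>.\<close>

lemma baskakov_basis_weighted_central_moment2:
  assumes "n \<ge> 1" "y \<ge> 0"
  obtains L where "(\<lambda>k. baskakov_basis n y k * ((real k / n - y)\<^sup>2 * (1 + (real k / n)\<^sup>2))) sums L"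
    "L \<le> 54 * (1 + y\<^sup>2)\<^sup>2 / n"
proof
  define r where "r = 1 / real n"
  have r: "0 \<le> r" "r \<le> 1" "real n * r = 1" using assms by (auto simp: r_def)
  define Q where "Q = y ^ 4 * ((1 + r) * (1 + 6 * r)) + y ^ 3 * (1 + 12 * r * (1 + r))
      + y\<^sup>2 * (5 * r + 7 * r\<^sup>2) + y * r\<^sup>2"
  note m = baskakov_basis_central_moment2[OF assms] baskakov_basis_moment2[OF assms]
    baskakov_basis_moment3[OF assms] baskakov_basis_moment4[OF assms]
  \<comment> \<open>With \<open>t = k / n\<close>, the summand expands as \<open>(t - y)\<^sup>2 + t
    ^ 4 - 2 * y * t ^ 3 + y\<^sup>2 * t\<^sup>2\<close>.\<close>
  have "(\<lambda>k. baskakov_basis n y k * (real k / n - y)\<^sup>2 +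
      (baskakov_basis n y k * real k ^ 4 * r ^ 4 - baskakov_basis n y k * real k ^ 3 * (2 * y * r ^ 3)
        + baskakov_basis n y k * real k ^ 2 * (y\<^sup>2 * r\<^sup>2))) sums
      (y * (1 + y) / n +
      ((n * y * ((real n + 1) * y * ((real n + 2) * y * ((real n + 3) * y + 6) + 7) + 1)) * r ^ 4
      - (n * y * ((real n + 1) * y * ((real n + 2) * y + 3) + 1)) * (2 * y * r ^ 3)
      + (n * y * ((real n + 1) * y + 1)) * (y\<^sup>2 * r\<^sup>2)))"
    by (intro sums_add sums_diff sums_mult2 m)
  also have "(n * y * ((real n + 1) * y * ((real n + 2) * y * ((real n + 3) * y + 6) + 7) + 1)) * r ^ 4 =
      (real n * r) * y * ((real n * r + r) * y * ((real n * r + 2 * r) * y * ((real n * r + 3 * r) * y + 6 * r) + 7 * r\<^sup>2) + r ^ 3)"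
    by (simp add: algebra_simps power2_eq_square power3_eq_cube power4_eq_xxxx)
  also have "(n * y * ((real n + 1) * y * ((real n + 2) * y + 3) + 1)) * (2 * y * r ^ 3) =
      2 * y * ((real n * r) * y * ((real n * r + r) * y * ((real n * r + 2 * r) * y + 3 * r) + r\<^sup>2))"
    by (simp add: algebra_simps power2_eq_square power3_eq_cube)
  also have "(n * y * ((real n + 1) * y + 1)) * (y\<^sup>2 * r\<^sup>2) = y\<^sup>2 * ((real n * r) * y * ((real n * r + r) * y + r))"
    by (simp add: algebra_simps power2_eq_square)
  finally have "(\<lambda>k. baskakov_basis n y k * ((real k / n - y)\<^sup>2 * (1 + (real k / n)\<^sup>2))) sums
     (y * (1 + y) / n +
       (1 * y * ((1 + r) * y * ((1 + 2 * r) * y * ((1 + 3 * r) * y + 6 * r) + 7 * r\<^sup>2) + r ^ 3)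
       - 2 * y * (1 * y * ((1 + r) * y * ((1 + 2 * r) * y + 3 * r) + r\<^sup>2))
       + y\<^sup>2 * (1 * y * ((1 + r) * y + r))))"
    unfolding r by (simp add: r_def algebra_simps power2_eq_square power3_eq_cube power4_eq_xxxx)
  also have "y * (1 + y) / n = r * (y + y\<^sup>2)"
    by (simp add: r_def power2_eq_square ring_distribs add_divide_distrib)
  \<comment> \<open>The contributions free of \<open>r\<close> are
    \<open>y ^ 4 - 2 * y ^ 4 + y ^ 4 = 0\<close>, so a factor \<open>r\<close> splits off;
    \<open>Q\<close> is the cofactor belonging to
    \<open>(t - y)\<^sup>2 * t\<^sup>2\<close>.\<close>
  also have "r * (y + y\<^sup>2) +
       (1 * y * ((1 + r) * y * ((1 + 2 * r) * y * ((1 + 3 * r) * y + 6 * r) + 7 * r\<^sup>2) + r ^ 3)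
       - 2 * y * (1 * y * ((1 + r) * y * ((1 + 2 * r) * y + 3 * r) + r\<^sup>2))
       + y\<^sup>2 * (1 * y * ((1 + r) * y + r))) = r * (y + y\<^sup>2 + Q)"
    unfolding Q_def by algebra
  finally show "(\<lambda>k. baskakov_basis n y k * ((real k / n - y)\<^sup>2 * (1 + (real k / n)\<^sup>2))) sums (r * (y + y\<^sup>2 + Q))" .
  define w where "w = (1 + y\<^sup>2)\<^sup>2"
  have w: "w = 1 + 2 * y\<^sup>2 + y ^ 4" by (simp add: w_def power2_eq_square power4_eq_xxxx algebra_simps)
  have y2: "0 \<le> y\<^sup>2" "y\<^sup>2 \<le> w" "y ^ 4 \<le> w" using w by auto
  have "0 \<le> (y - 1)\<^sup>2" "0 \<le> y\<^sup>2 * (y - 1)\<^sup>2" by auto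
  then have "2 * y \<le> 1 + y\<^sup>2" "2 * y ^ 3 \<le> y ^ 4 + y\<^sup>2"
    by (auto simp: power2_eq_square power3_eq_cube power4_eq_xxxx algebra_simps)
  then have y1: "y \<le> w" "y ^ 3 \<le> w" using w y2 zero_le_power[OF \<open>y \<ge> 0\<close>, of 4] by linarith+
  have r2: "r\<^sup>2 \<le> 1" "0 \<le> r\<^sup>2" using r by (auto simp: power_le_one)
  have w0: "0 \<le> w" by (simp add: w_def)
  \<comment> \<open>The constants 14, 25, 12 and 1 are the coefficients at \<open>r = 1\<close>.
    Together with one \<open>w\<close> each for \<open>y\<close> and \<open>y\<^sup>2\<close> they
    add up to 54.\<close>
  have "y ^ 4 * ((1 + r) * (1 + 6 * r)) \<le> w * 14"
    using y2 r r2 w0 by (intro mult_mono) (auto simp: algebra_simps power2_eq_square)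
  moreover have "y ^ 3 * (1 + 12 * r * (1 + r)) \<le> w * 25"
    using y1 r r2 w0 by (intro mult_mono) (auto simp: algebra_simps power2_eq_square)
  moreover have "y\<^sup>2 * (5 * r + 7 * r\<^sup>2) \<le> w * 12"
    using y2 r r2 w0 by (intro mult_mono) auto
  moreover have "y * r\<^sup>2 \<le> w * 1"
    using y1 r r2 w0 by (intro mult_mono) auto
  ultimately have "y + y\<^sup>2 + Q \<le> 54 * w" using y1 y2 by (simp add: Q_def)
  then have "r * (y + y\<^sup>2 + Q) \<le> r * (54 * w)" using r by (intro mult_left_mono)
  then show "r * (y + y\<^sup>2 + Q) \<le> 54 * (1 + y\<^sup>2)\<^sup>2 / n" by (simp add: r_def w_def)
qed

section \<open>Error estimate for the classical operator\<close>

text \<open>On the right, \<open>y\<close> enters only through the weight to the power 3/2, so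
  dividing by it leaves a bound uniform in \<open>y\<close>. The proof majorizes
  \<open>\<bar>h t - h y\<bar>\<close> pointwise by a function whose averages are known and then
  averages over the nodes.\<close>

lemma baskakov_basis_weighted_error:
  fixes h :: "real \<Rightarrow> real"
  assumes bound: "\<And>t. t \<ge> 0 \<Longrightarrow> \<bar>h t\<bar> \<le> M * (1 + t\<^sup>2)"
    and uc: "\<And>s t. s \<ge> 0 \<Longrightarrow> t \<ge> 0 \<Longrightarrow> \<bar>s - t\<bar> < \<delta> \<Longrightarrow> \<bar>h s / (1 + s\<^sup>2) - h t / (1 + t\<^sup>2)\<bar> \<le> \<epsilon>"
    and "\<delta> > 0" "\<epsilon> \<ge> 0" "n \<ge> 1" "y \<ge> 0"
    and summable: "summable (\<lambda>k. h (real k / n) * baskakov_basis n y k)"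
  shows "\<bar>(\<Sum>k. h (real k / n) * baskakov_basis n y k) - h y\<bar>
    \<le> (3 * \<epsilon> + (57 * M / \<delta> + 30 * M) / sqrt n) * sqrt (1 + y\<^sup>2) ^ 3"
proof -
  define A where "A = sqrt (1 + y\<^sup>2)"
  define s where "s = A / sqrt n"
  \<comment> \<open>The coefficient of \<open>\<bar>t - y\<bar> * (1 + t\<^sup>2)\<close>:
    \<open>2 * M / \<delta>\<close> from the variation of the quotient
    \<open>h t / (1 + t\<^sup>2)\<close>, \<open>M\<close> from that of the weight.\<close>
  define C where "C = 2 * M / \<delta> + M"
  let ?b = "baskakov_basis n y"
  have A: "A > 0" "A\<^sup>2 = 1 + y\<^sup>2" by (auto simp: A_def add_pos_nonneg)
  have n: "sqrt n > 0" "(sqrt n)\<^sup>2 = real n" using \<open>n \<ge> 1\<close> by auto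
  have s: "s > 0" using A n by (simp add: s_def)
  have M: "M \<ge> 0" using bound[of 0] by simp
  have C: "C \<ge> 0" using M \<open>\<delta> > 0\<close> by (simp add: C_def)
  \<comment> \<open>The majorant: \<open>\<epsilon> * (1 + t\<^sup>2) + (C * (1 + t\<^sup>2) + M *
    A\<^sup>2) * \<bar>t - y\<bar>\<close> with \<open>\<bar>t - y\<bar>\<close> replaced by
    \<open>(s + (t - y)\<^sup>2 / s) / 2\<close>, which makes it a combination of the moments
    computed above.\<close>
  define G where "G t = \<epsilon> * (1 + t\<^sup>2) + C / 2 * (s * (1 + t\<^sup>2) + (t - y)\<^sup>2 * (1 + t\<^sup>2) / s)
    + M * A\<^sup>2 / 2 * (s + (t - y)\<^sup>2 / s)" for t
  have pointwise: "\<bar>h t - h y\<bar> \<le> G t" if "t \<ge> 0" for t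
  proof -
    define F where "F u = h u / (1 + u\<^sup>2)" for u
    have pos: "1 + u\<^sup>2 > 0" for u :: real by (simp add: add_pos_nonneg)
    have F: "h u = F u * (1 + u\<^sup>2)" for u using pos[of u] by (simp add: F_def)
    have FM: "\<bar>F u\<bar> \<le> M" if "u \<ge> 0" for u
      using bound[OF that] pos[of u] by (simp add: F_def abs_mult divide_le_eq)
    \<comment> \<open>Replaces absolute moments by even ones; \<open>s = A / sqrt n\<close> is the order of magnitude of \<open>\<bar>t - y\<bar>\<close>.\<close>
    have am_gm: "\<bar>t - y\<bar> \<le> (s + (t - y)\<^sup>2 / s) / 2"
    proof -
      have "0 \<le> (\<bar>t - y\<bar> - s)\<^sup>2" by simp
      then have "2 * \<bar>t - y\<bar> * s \<le> s\<^sup>2 + (t - y)\<^sup>2" by (simp add: power2_diff)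
      then show ?thesis using s by (simp add: field_simps power2_eq_square)
    qed
    have "\<bar>F t - F y\<bar> \<le> \<epsilon> + 2 * M / \<delta> * \<bar>t - y\<bar>"
    proof (cases "\<bar>t - y\<bar> < \<delta>")
      case True
      then have "\<bar>F t - F y\<bar> \<le> \<epsilon>" using uc[of t y] that \<open>y \<ge> 0\<close> by (simp add: F_def)
      moreover have "0 \<le> 2 * M / \<delta> * \<bar>t - y\<bar>" using M \<open>\<delta> > 0\<close> by simp
      ultimately show ?thesis by linarith
    next
      case False
      then have "2 * M / \<delta> * \<delta> \<le> 2 * M / \<delta> * \<bar>t - y\<bar>"
        using M \<open>\<delta> > 0\<close> by (intro mult_left_mono) auto
      then show ?thesis using FM[of t] FM[of y] that \<open>y \<ge> 0\<close> \<open>\<epsilon> \<ge> 0\<close> \<open>\<delta> > 0\<close> by simp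
    qed
    then have 1: "\<bar>(F t - F y) * (1 + t\<^sup>2)\<bar> \<le> (\<epsilon> + 2 * M / \<delta> * \<bar>t - y\<bar>) * (1 + t\<^sup>2)"
      using pos[of t] by (simp add: abs_mult)
    have 2: "\<bar>F y * (t\<^sup>2 - y\<^sup>2)\<bar> \<le> M * (\<bar>t - y\<bar> * ((1 + t\<^sup>2) + A\<^sup>2))"
    proof -
      have "0 \<le> (t - 1)\<^sup>2" "0 \<le> (y - 1)\<^sup>2" by auto
      then have "t + y \<le> (1 + t\<^sup>2) + A\<^sup>2"
        using that \<open>y \<ge> 0\<close> by (simp add: A power2_diff)
      moreover have "\<bar>t\<^sup>2 - y\<^sup>2\<bar> = \<bar>t - y\<bar> * (t + y)"
        using that \<open>y \<ge> 0\<close> by (simp add: power2_eq_square square_diff_square_factored abs_mult mult.commute)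
      ultimately have "\<bar>t\<^sup>2 - y\<^sup>2\<bar> \<le> \<bar>t - y\<bar> * ((1 + t\<^sup>2) + A\<^sup>2)" by (simp add: mult_left_mono)
      then show ?thesis using FM[OF \<open>y \<ge> 0\<close>] M unfolding abs_mult by (intro mult_mono) auto
    qed
    \<comment> \<open>Product splitting: first \<open>F\<close> varies against the weight at
      \<open>t\<close>, then the weight varies against \<open>F y\<close>.\<close>
    have "h t - h y = (F t - F y) * (1 + t\<^sup>2) + F y * (t\<^sup>2 - y\<^sup>2)"
      unfolding F by (simp add: algebra_simps)
    then have "\<bar>h t - h y\<bar> \<le> (\<epsilon> + 2 * M / \<delta> * \<bar>t - y\<bar>) * (1 + t\<^sup>2) + M * (\<bar>t - y\<bar> * ((1 + t\<^sup>2) + A\<^sup>2))"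
      using 1 2 by linarith
    also have "\<dots> = \<epsilon> * (1 + t\<^sup>2) + (C * (1 + t\<^sup>2) + M * A\<^sup>2) * \<bar>t - y\<bar>"
      by (simp add: C_def algebra_simps)
    also have "\<dots> \<le> \<epsilon> * (1 + t\<^sup>2) + (C * (1 + t\<^sup>2) + M * A\<^sup>2) * ((s + (t - y)\<^sup>2 / s) / 2)"
      using C M A pos[of t] by (intro add_left_mono mult_left_mono am_gm) auto
    also have "\<dots> = G t"
    proof -
      define q where "q = (t - y)\<^sup>2 / s"
      have "(t - y)\<^sup>2 * (1 + t\<^sup>2) / s = q * (1 + t\<^sup>2)" by (simp add: q_def)
      then show ?thesis by (simp add: G_def flip: q_def) (simp add: field_simps)
    qed
    finally show ?thesis .
  qed
  obtain S where S: "(\<lambda>k. ?b k * (1 + (real k / n)\<^sup>2)) sums S" "S \<le> 3 * A\<^sup>2"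
    using baskakov_basis_weighted_moment2[OF \<open>n \<ge> 1\<close> \<open>y \<ge> 0\<close>] unfolding A by blast
  obtain T where T: "(\<lambda>k. ?b k * ((real k / n - y)\<^sup>2 * (1 + (real k / n)\<^sup>2))) sums T" "T \<le> 54 * (A\<^sup>2)\<^sup>2 / n"
    using baskakov_basis_weighted_central_moment2[OF \<open>n \<ge> 1\<close> \<open>y \<ge> 0\<close>] unfolding A by blast
  note m0 = baskakov_basis_sums_1[OF \<open>n \<ge> 1\<close> \<open>y \<ge> 0\<close>]
  note m2 = baskakov_basis_central_moment2[OF \<open>n \<ge> 1\<close> \<open>y \<ge> 0\<close>]
  have "(\<lambda>k. \<epsilon> * (?b k * (1 + (real k / n)\<^sup>2))
      + C / 2 * (s * (?b k * (1 + (real k / n)\<^sup>2)) + ?b k * ((real k / n - y)\<^sup>2 * (1 + (real k / n)\<^sup>2)) / s)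
      + M * A\<^sup>2 / 2 * (s * ?b k + ?b k * (real k / n - y)\<^sup>2 / s)) sums
      (\<epsilon> * S + C / 2 * (s * S + T / s) + M * A\<^sup>2 / 2 * (s * 1 + (y * (1 + y) / n) / s))"
    by (intro sums_add sums_mult sums_divide S T m0 m2)
  then have G: "(\<lambda>k. ?b k * G (real k / n)) sums
      (\<epsilon> * S + C / 2 * (s * S + T / s) + M * A\<^sup>2 / 2 * (s * 1 + (y * (1 + y) / n) / s))" (is "_ sums ?R")
    by (simp add: G_def algebra_simps)
  have "(\<lambda>k. h (real k / n) * ?b k - h y * ?b k) sums ((\<Sum>k. h (real k / n) * ?b k) - h y * 1)"
    by (intro sums_diff summable_sums summable sums_mult m0)
  then have D: "(\<lambda>k. ?b k * (h (real k / n) - h y)) sums ((\<Sum>k. h (real k / n) * ?b k) - h y)"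
    by (simp add: algebra_simps)
  have "norm (?b k * (h (real k / n) - h y)) \<le> ?b k * G (real k / n)" for k
    using pointwise[of "real k / n"] baskakov_basis_nonneg[OF \<open>y \<ge> 0\<close>, of n k]
    by (simp add: abs_mult mult_left_mono)
  from norm_sums_le[OF D G this]
  have "\<bar>(\<Sum>k. h (real k / n) * ?b k) - h y\<bar> \<le> ?R" by simp
  \<comment> \<open>The choice of \<open>s\<close> balances \<open>s * A\<^sup>2\<close> and
    \<open>(A ^ 4 / n) / s\<close>: both equal \<open>A ^ 3 / sqrt n\<close>. The constants are 57 =
    3 + 54 from \<open>S\<close> and \<open>T\<close>, and 3 = 1 + 2 from the total mass and the
    variance.\<close>
  also have "\<dots> \<le> \<epsilon> * (3 * A ^ 3) + C / 2 * (57 * (A ^ 3 / sqrt n)) + M / 2 * (3 * (A ^ 3 / sqrt n))"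
  proof (intro add_mono)
    have "A \<ge> 1" by (simp add: A_def)
    then have "A\<^sup>2 * 1 \<le> A\<^sup>2 * A" by (intro mult_left_mono) auto
    then show "\<epsilon> * S \<le> \<epsilon> * (3 * A ^ 3)"
      using S \<open>\<epsilon> \<ge> 0\<close> by (intro mult_left_mono) (auto simp: power2_eq_square power3_eq_cube)
    have "s * S \<le> s * (3 * A\<^sup>2)" using S s by (intro mult_left_mono) auto
    also have "\<dots> = 3 * (A ^ 3 / sqrt n)" by (simp add: s_def power2_eq_square power3_eq_cube)
    finally have a: "s * S \<le> 3 * (A ^ 3 / sqrt n)" .
    have "T / s \<le> (54 * (A\<^sup>2)\<^sup>2 / (sqrt n)\<^sup>2) / s" using T s n by (intro divide_right_mono) auto
    also have "\<dots> = 54 * (A ^ 3 / sqrt n)"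
      using A(1) n(1) by (simp add: s_def power2_eq_square power3_eq_cube del: real_sqrt_mult_self)
    finally have "s * S + T / s \<le> 57 * (A ^ 3 / sqrt n)" using a by simp
    then show "C / 2 * (s * S + T / s) \<le> C / 2 * (57 * (A ^ 3 / sqrt n))"
      using C by (intro mult_left_mono) auto
    have "0 \<le> (y - 1)\<^sup>2" by simp
    then have "y * (1 + y) \<le> 2 * A\<^sup>2" using \<open>y \<ge> 0\<close> unfolding A by (simp add: power2_eq_square algebra_simps)
    then have "(y * (1 + y) / n) / s \<le> (2 * A\<^sup>2 / (sqrt n)\<^sup>2) / s" using s n by (auto intro!: divide_right_mono)
    also have "\<dots> = 2 * (A / sqrt n)"
      using A(1) n(1) by (simp add: s_def power2_eq_square del: real_sqrt_mult_self)
    finally have "s * 1 + (y * (1 + y) / n) / s \<le> 3 * (A / sqrt n)" by (simp add: s_def)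
    then have "M * A\<^sup>2 / 2 * (s * 1 + (y * (1 + y) / n) / s) \<le> M * A\<^sup>2 / 2 * (3 * (A / sqrt n))"
      using M by (intro mult_left_mono) auto
    then show "M * A\<^sup>2 / 2 * (s * 1 + (y * (1 + y) / n) / s) \<le> M / 2 * (3 * (A ^ 3 / sqrt n))"
      by (simp add: power2_eq_square power3_eq_cube)
  qed
  \<comment> \<open>Here \<open>30 * M\<close> is \<open>57 * M / 2\<close>, from the summand
    \<open>M\<close> of \<open>C\<close>, plus \<open>3 * M / 2\<close>.\<close>
  also have "\<dots> = (3 * \<epsilon> + (57 * M / \<delta> + 30 * M) / sqrt n) * A ^ 3"
    using n(1) \<open>\<delta> > 0\<close> by (simp add: C_def field_simps)
  finally show ?thesis unfolding A_def .
qed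

section \<open>Transfer along \<rho> and convergence in norm\<close>

text \<open>Mean value theorem with a derivative of at least 1. Applied to points
  \<open>rho_inv \<rho> t\<close>, it makes the inverse 1-Lipschitz.\<close>

lemma rho_expanding:
  assumes "admissible_rho \<rho>" "0 \<le> a" "0 \<le> b"
  shows "\<bar>b - a\<bar> \<le> \<bar>\<rho> b - \<rho> a\<bar>"
proof -
  obtain \<rho>' where d: "\<And>x. x \<ge> 0 \<Longrightarrow> (\<rho> has_real_derivative \<rho>' x) (at x within {0..})"
    and i: "(INF x\<in>{0..}. ereal (\<rho>' x)) \<ge> 1"
    using assms(1) by (auto simp: admissible_rho_def)
  have ge1: "\<rho>' x \<ge> 1" if "x \<ge> 0" for x
    using i that by (auto simp: le_INF_iff)
  have grow: "v - u \<le> \<rho> v - \<rho> u" if "0 \<le> u" "u < v" for u v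
  proof -
    have "\<exists>\<xi>\<in>{u<..<v}. \<rho> v - \<rho> u = \<rho>' \<xi> * (v - u)"
      by (rule mvt_simple[where f' = "\<lambda>x. (*) (\<rho>' x)"])
        (use that in \<open>simp, intro has_derivative_subset[OF d[unfolded has_field_derivative_def]], auto\<close>)
    then obtain \<xi> where "\<xi> > u" "\<rho> v - \<rho> u = \<rho>' \<xi> * (v - u)" by auto
    moreover have "1 * (v - u) \<le> \<rho>' \<xi> * (v - u)"
      using ge1[of \<xi>] \<open>\<xi> > u\<close> that by (intro mult_right_mono) auto
    ultimately show ?thesis by simp
  qed
  show ?thesis
    using grow[of a b] grow[of b a] assms by (cases a b rule: linorder_cases) auto
qed

theorem theorem5:
  fixes \<rho> f :: "real \<Rightarrow> real"
  assumes "admissible_rho \<rho>"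
    and "f \<in> U_weight (weight \<rho>)"
  shows "(\<lambda>n. weighted_norm (\<lambda>x. weight \<rho> x powr (3 / 2)) (\<lambda>x. baskakov \<rho> n f x - f x))
           \<longlonglongrightarrow> 0"
proof -
  let ?w = "\<lambda>x. weight \<rho> x powr (3 / 2)"
  define N where "N n = weighted_norm ?w (\<lambda>x. baskakov \<rho> n f x - f x)" for n
  have bij: "bij_betw \<rho> {0..} {0..}" using assms(1) by (rule admissible_rho_bij_betw)
  have inv: "\<rho> (rho_inv \<rho> t) = t" "rho_inv \<rho> t \<ge> 0" if "t \<ge> 0" for t
    using bij that f_the_inv_into_f_bij_betw[OF bij, of t] the_inv_into_into[of \<rho> "{0..}" t "{0..}"]
    by (auto simp: rho_inv_def bij_betw_def)
  have inv': "rho_inv \<rho> (\<rho> x) = x" "\<rho> x \<ge> 0" if "x \<ge> 0" for x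
    using bij that by (auto simp: rho_inv_def bij_betw_def the_inv_into_f_f)
  define h where "h t = f (rho_inv \<rho> t)" for t
  have f: "f \<in> C_weight (weight \<rho>)" and uc: "uniformly_continuous_on {0..} (\<lambda>x. f x / weight \<rho> x)"
    using assms(2) by (auto simp: U_weight_def)
  then obtain M where M: "\<And>x. x \<ge> 0 \<Longrightarrow> \<bar>f x\<bar> \<le> M * weight \<rho> x"
    by (auto simp: C_weight_def)
  have hM: "\<bar>h t\<bar> \<le> M * (1 + t\<^sup>2)" if "t \<ge> 0" for t
    using M[of "rho_inv \<rho> t"] inv[OF that] by (simp add: h_def weight_def)
  have powr: "weight \<rho> x powr (3 / 2) = sqrt (1 + (\<rho> x)\<^sup>2) ^ 3" for x
  proof -
    have "weight \<rho> x > 0" by (simp add: weight_def add_pos_nonneg)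
    then have "weight \<rho> x powr (3 / 2) = (weight \<rho> x powr (1 / 2)) powr real 3"
      by (simp add: powr_powr)
    also have "\<dots> = sqrt (weight \<rho> x) ^ 3"
      using \<open>weight \<rho> x > 0\<close> by (subst powr_realpow) (auto simp: powr_half_sqrt)
    finally show ?thesis by (simp add: weight_def)
  qed
  \<comment> \<open>The supremum dominates the quotient at \<open>x = 0\<close>, which settles the
    lower half of the order criterion for convergence in the extended reals.\<close>
  have nonneg: "0 \<le> N n" for n
  proof -
    have "0 \<le> ereal (\<bar>baskakov \<rho> n f 0 - f 0\<bar> / ?w 0)" by simp
    also have "\<dots> \<le> N n" unfolding N_def weighted_norm_def by (rule SUP_upper) simp
    finally show ?thesis .
  qed
  have small: "eventually (\<lambda>n. N n < a) sequentially" if a: "0 < a" for a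
  proof -
    \<comment> \<open>A real \<open>e\<close> strictly below \<open>a\<close> serves two ends:
      \<open>a\<close> may be infinite, and a supremum of terms at most \<open>e\<close> is only
      known to be at most \<open>e\<close>.\<close>
    obtain e where e: "0 < ereal e" "ereal e < a" using ereal_dense2[OF a] by blast
    \<comment> \<open>The factor 3 in the error estimate turns \<open>e / 6\<close> into
      \<open>e / 2\<close>; the other half is left for \<open>K / sqrt n\<close>.\<close>
    then have "e / 6 > 0" by simp
    then obtain \<delta> where \<delta>: "\<delta> > 0" "\<And>x x'. x \<in> {0..} \<Longrightarrow> x' \<in> {0..} \<Longrightarrow> \<bar>x' - x\<bar> < \<delta> \<Longrightarrow>
        \<bar>f x' / weight \<rho> x' - f x / weight \<rho> x\<bar> < e / 6"
      using uc unfolding uniformly_continuous_on_def dist_real_def by blast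
    have huc: "\<bar>h s / (1 + s\<^sup>2) - h t / (1 + t\<^sup>2)\<bar> \<le> e / 6"
      if "s \<ge> 0" "t \<ge> 0" "\<bar>s - t\<bar> < \<delta>" for s t
      \<comment> \<open>Because the inverse of \<open>\<rho>\<close> is 1-Lipschitz, the
        \<open>\<delta>\<close> found for \<open>f / weight \<rho>\<close> works unchanged for
        \<open>h\<close>.\<close>
      using \<delta>(2)[of "rho_inv \<rho> t" "rho_inv \<rho> s"] rho_expanding[OF assms(1), of "rho_inv \<rho> t" "rho_inv \<rho> s"]
        inv[OF that(1)] inv[OF that(2)] that(3) by (simp add: h_def weight_def)
    define K where "K = 57 * M / \<delta> + 30 * M"
    have "(\<lambda>n. K / sqrt (real n)) \<longlonglongrightarrow> 0"
      by (intro tendsto_divide_0[OF tendsto_const] filterlim_at_top_imp_at_infinity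
          filterlim_compose[OF sqrt_at_top] filterlim_real_sequentially)
    then have "eventually (\<lambda>n. K / sqrt (real n) < e / 2) sequentially"
      using e by (intro order_tendstoD(2)) auto
    then show ?thesis
      using eventually_ge_at_top[of 1]
    proof eventually_elim
      case (elim n)
      have "\<bar>baskakov \<rho> n f x - f x\<bar> / ?w x \<le> e" if "x \<ge> 0" for x
      proof -
        define y where "y = \<rho> x"
        have y: "y \<ge> 0" "h y = f x" using inv' that by (auto simp: y_def h_def)
        \<comment> \<open>After substituting \<open>y = \<rho> x\<close>, the generalized operator
          is the classical one applied to \<open>h\<close> at \<open>y\<close>.\<close>
        have eq: "baskakov_term \<rho> n f x = (\<lambda>k. h (real k / n) * baskakov_basis n y k)"
          by (simp add: baskakov_term_def baskakov_basis_def h_def y_def fun_eq_iff)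
        have "\<bar>baskakov \<rho> n f x - f x\<bar> \<le> (3 * (e / 6) + K / sqrt n) * sqrt (1 + y\<^sup>2) ^ 3"
          using baskakov_basis_weighted_error[OF hM huc \<delta>(1) _ elim(2) y(1)] e
            summable_baskakov_term[OF assms(1) f elim(2) that]
          by (simp add: baskakov_def eq y K_def)
        also have "\<dots> \<le> e * sqrt (1 + y\<^sup>2) ^ 3"
        proof (rule mult_right_mono)
          show "3 * (e / 6) + K / sqrt n \<le> e" using elim(1) by linarith
        qed simp
        finally show ?thesis
          unfolding powr y_def by (subst pos_divide_le_eq) (auto simp: add_pos_nonneg)
      qed
      then have "N n \<le> ereal e"
        unfolding N_def weighted_norm_def by (intro SUP_least) auto
      then show "N n < a" using e by simp
    qed
  qed
  have "N \<longlonglongrightarrow> 0"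
  proof (rule order_tendstoI)
    show "eventually (\<lambda>n. a < N n) sequentially" if "a < 0" for a
      using less_le_trans[OF that nonneg] by simp
  qed (rule small)
  then show ?thesis unfolding N_def .
qed

end
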